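(* Let $K$ be a finite abstract simplicial complex with vertex set $V(K)$, and let $d\ge 2$. Let $\omega_{d-2}$ denote the area (surface measure) of the unit sphere $\mathbb{S}^{d-2}$, and set $$C_d = 2\,\omega_{d-2}\int_0^{\pi/2}\cos(\theta)\sin^{d-2}(\theta)\,d\theta \qquad\text{and}\qquad C_K=\max_{v\in V(K)}\bigl|\{\sigma\in K \mid v\in\sigma\}\bigr|.$$ Then for any two embeddings $f: K\to\mathbb{R}^d$ and $g:K\to\mathbb{R}^d$ one has $$d_{\mathrm{ECT}}\bigl(\mathrm{ECT}(f(K)),\mathrm{ECT}(g(K))\bigr)\le 2\,C_K\,C_d\sum_{v\in V(K)}\|f(v)-g(v)\|_2 .$$
   Context: An abstract simplicial complex $K$ on a vertex set $V(K)$ is a collection of non-empty subsets of $V(K)$ (simplices) closed under taking non-empty subsets; a simplex with $k+1$ vertices has dimension $|\sigma|=k$. All complexes are finite. An embedding $f:K\to\mathbb{R}^d$ is a geometric realization of $K$: it is given by a map $f:V(K)\to\mathbb{R}^d$ such that for every simplex $\sigma=\{v_0,\dots,v_k\}\in K$ the points $f(v_0),\dots,f(v_k)$ are affinely independent, $f(\sigma)$ denotes their convex hull (a geometric $k$-simplex), and the intersection of any two of the geometric simplices $f(\sigma), f(\tau)$ is empty or a common face. $f(K)$ denotes the resulting geometric simplicial complex. The Euler characteristic of a finite simplicial complex $L$ is $\chi(L)=\sum_{\sigma\in L}(-1)^{|\sigma|}$ (so $\chi(\emptyset)=0$). For a geometric simplicial complex $L$ in $\mathbb{R}^d$ and a direction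 $\nu\in\mathbb{S}^{d-1}$, the height function is $h_\nu(\sigma)=\max_{v\in V(\sigma)}\langle v,\nu\rangle$, where $V(\sigma)$ is the set of vertices of $\sigma\in L$ and $\langle\cdot,\cdot\rangle$ is the dot product. For $a\in\mathbb{R}$, $L_{\nu,a}=\{\sigma\in L\mid h_\nu(\sigma)\le a\}$, which is a subcomplex of $L$. The Euler characteristic curve is $\mathrm{ECC}_\nu(L):\mathbb{R}\to\mathbb{Z}$, $\mathrm{ECC}_\nu(L,a)=\chi(L_{\nu,a})$, and the Euler characteristic transform $\mathrm{ECT}(L)$ is the map $\nu\mapsto \mathrm{ECC}_\nu(L)$ on $\mathbb{S}^{d-1}$. For two embeddings $f,g$ of the same abstract complex $K$, the ECT distance is $$d_{\mathrm{ECT}}(\mathrm{ECT}(f(K)),\mathrm{ECT}(g(K)))=\int_{\mathbb{S}^{d-1}}\|\mathrm{ECC}_\nu(f(K))-\mathrm{ECC}_\nu(g(K))\|_1\,d\nu,$$ where $\|\mathrm{ECC}_\nu(f(K))-\mathrm{ECC}_\nu(g(K))\|_1=\int_{\mathbb{R}}|\mathrm{ECC}_\nu(f(K),a)-\mathrm{ECC}_\nu(g(K),a)|\,da$ and $d\nu$ is the surface measure on $\mathbb{S}^{d-1}$. For $d=2$, $\omega_0=2$ is the number of points of $\mathbb{S}^0$. *)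

theory Defs
  imports "HOL-Analysis.Analysis"
begin

section \<open>Simplicial complexes and embeddings\<close>

text \<open>Elements of \<open>V\<close> need not all occur as simplices \<open>{v}\<close> of \<open>K\<close>.\<close>

definition abstract_simplicial_complex :: "'v set \<Rightarrow> 'v set set \<Rightarrow> bool" where
  "abstract_simplicial_complex V K \<longleftrightarrow>
     finite V \<and> (\<forall>\<sigma>\<in>K. \<sigma> \<noteq> {} \<and> \<sigma> \<subseteq> V) \<and>
     (\<forall>\<sigma>\<in>K. \<forall>\<tau>. \<tau> \<subseteq> \<sigma> \<and> \<tau> \<noteq> {} \<longrightarrow> \<tau> \<in> K)"

definition geom_simplex :: "('v \<Rightarrow> 'a::euclidean_space) \<Rightarrow> 'v set \<Rightarrow> 'a set" where
  "geom_simplex f \<sigma> = convex hull (f ` \<sigma>)"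

definition geom_complex :: "('v \<Rightarrow> 'a::euclidean_space) \<Rightarrow> 'v set set \<Rightarrow> 'a set set" where
  "geom_complex f K = geom_simplex f ` K"

text \<open>
  A geometric realization of \<open>K\<close> sends distinct vertices of \<open>K\<close> to distinct points. This is
  required explicitly: the conditions on single simplices and on intersections of geometric
  simplices do not exclude that two vertices not joined by an edge are mapped to the same point.
  Injectivity also makes \<open>\<not> affine_dependent (f ` \<sigma>)\<close>, a property of a set of points, say that
  the family of points \<open>f v\<close>, for \<open>v\<close> in \<open>\<sigma>\<close>, is affinely independent.
\<close>

definition embedding :: "'v set set \<Rightarrow> ('v \<Rightarrow> 'a::euclidean_space) \<Rightarrow> bool" where
  "embedding K f \<longleftrightarrow>
     inj_on f (\<Union>K) \<and>
     (\<forall>\<sigma>\<in>K. \<not> affine_dependent (f ` \<sigma>)) \<and>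
     (\<forall>\<sigma>\<in>K. \<forall>\<tau>\<in>K.
        geom_simplex f \<sigma> \<inter> geom_simplex f \<tau> = {} \<or>
        (geom_simplex f \<sigma> \<inter> geom_simplex f \<tau>) face_of geom_simplex f \<sigma> \<and>
        (geom_simplex f \<sigma> \<inter> geom_simplex f \<tau>) face_of geom_simplex f \<tau>)"


section \<open>Euler characteristic curve and transform\<close>

text \<open>A geometric simplex is a set of points; its vertices are its extreme points.\<close>

definition simplex_vertices :: "'a::euclidean_space set \<Rightarrow> 'a set" where
  "simplex_vertices S = {v. v extreme_point_of S}"

lemma simplex_vertices_geom_simplex:
  assumes "\<not> affine_dependent (f ` \<sigma>)"
  shows "simplex_vertices (geom_simplex f \<sigma>) = f ` \<sigma>"
  using assms
  by (auto simp: simplex_vertices_def geom_simplex_def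
        extreme_point_of_convex_hull_affine_independent)

definition simplex_dim :: "'a::euclidean_space set \<Rightarrow> nat" where
  "simplex_dim S = card (simplex_vertices S) - 1"

definition euler_char :: "'a::euclidean_space set set \<Rightarrow> int" where
  "euler_char L = (\<Sum>S\<in>L. (-1) ^ simplex_dim S)"

definition height :: "'a::euclidean_space \<Rightarrow> 'a set \<Rightarrow> real" where
  "height \<nu> S = Max ((\<lambda>v. v \<bullet> \<nu>) ` simplex_vertices S)"

definition sublevel_complex :: "'a::euclidean_space set set \<Rightarrow> 'a \<Rightarrow> real \<Rightarrow> 'a set set" where
  "sublevel_complex L \<nu> a = {S \<in> L. height \<nu> S \<le> a}"

definition ECC :: "'a::euclidean_space \<Rightarrow> 'a set set \<Rightarrow> real \<Rightarrow> int" where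
  "ECC \<nu> L a = euler_char (sublevel_complex L \<nu> a)"

definition ECT :: "'a::euclidean_space set set \<Rightarrow> 'a \<Rightarrow> real \<Rightarrow> int" where
  "ECT L = (\<lambda>\<nu>\<in>sphere 0 1. ECC \<nu> L)"


section \<open>Surface measure on the unit sphere\<close>

text \<open>
  The surface measure of a Borel set \<open>A\<close> of the unit sphere is the dimension of the ambient space
  times the volume of the cone \<open>{t *\<^sub>R u | 0 < t < 1, u \<in> A}\<close>, as in polar coordinates.
\<close>

definition surface_measure :: "'a::euclidean_space measure" where
  "surface_measure =
     scale_measure (of_nat DIM('a))
       (distr (restrict_space lborel (ball 0 1 - {0})) (restrict_space borel (sphere 0 1)) sgn)"

lemma space_surface_measure: "space (surface_measure :: 'a::euclidean_space measure) = sphere 0 1"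
  by (simp add: surface_measure_def space_scale_measure space_restrict_space)

lemma sets_surface_measure [measurable_cong]:
  "sets (surface_measure :: 'a::euclidean_space measure) = sets (restrict_space borel (sphere 0 1))"
  by (simp add: surface_measure_def)

lemma emeasure_surface_measure:
  fixes A :: "'a::euclidean_space set"
  assumes "A \<in> sets borel" "A \<subseteq> sphere 0 1"
  shows "emeasure surface_measure A =
           of_nat DIM('a) * emeasure lborel {t *\<^sub>R u | t u. 0 < t \<and> t < 1 \<and> u \<in> A}"
proof -
  have m: "sgn \<in> measurable (restrict_space lborel (ball 0 1 - {0::'a})) (restrict_space borel (sphere 0 1))"
    by (intro measurable_restrict_space2 measurable_restrict_space1)
      (auto simp: space_restrict_space norm_sgn)
  have A: "A \<in> sets (restrict_space borel (sphere (0::'a) 1))"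
    using assms by (auto simp: sets_restrict_space_iff)
  have eq: "sgn -` A \<inter> (ball 0 1 - {0}) = {t *\<^sub>R u | t u. 0 < t \<and> t < 1 \<and> u \<in> A}" (is "?L = ?R")
  proof (intro subset_antisym subsetI)
    fix x assume "x \<in> ?L"
    then have "x = norm x *\<^sub>R sgn x" "0 < norm x" "norm x < 1" "sgn x \<in> A"
      by (auto simp: sgn_div_norm)
    then show "x \<in> ?R" by blast
  next
    fix x assume "x \<in> ?R"
    then obtain t u where tu: "x = t *\<^sub>R u" "0 < t" "t < 1" "u \<in> A" by blast
    then have "norm u = 1" using assms(2) by auto
    with tu show "x \<in> ?L" by (auto simp: sgn_div_norm)
  qed
  have "emeasure surface_measure A = of_nat DIM('a) *
      emeasure (restrict_space lborel (ball 0 1 - {0::'a})) (sgn -` A \<inter> (ball 0 1 - {0}))"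
    using emeasure_distr[OF m A]
    by (simp add: surface_measure_def space_restrict_space)
  also have "emeasure (restrict_space lborel (ball 0 1 - {0::'a})) (sgn -` A \<inter> (ball 0 1 - {0})) =
      emeasure lborel (sgn -` A \<inter> (ball 0 1 - {0}))"
    by (intro emeasure_restrict_space) auto
  finally show ?thesis by (simp only: eq)
qed

text \<open>
  The area of the unit sphere \<open>S\<^sup>k\<close> in \<open>\<real>\<^sup>k\<^sup>+\<^sup>1\<close>, for a natural number \<open>k\<close>: here \<open>\<real>\<^sup>k\<^sup>+\<^sup>1\<close> is the
  space of functions on \<open>{..k}\<close> with the product Lebesgue measure.
\<close>

definition sphere_area :: "nat \<Rightarrow> real" where
  "sphere_area k = real (k + 1) *
     measure (\<Pi>\<^sub>M i\<in>{..k}. lborel :: real measure)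
       {x \<in> space (\<Pi>\<^sub>M i\<in>{..k}. lborel :: real measure). (\<Sum>i\<le>k. (x i)\<^sup>2) \<le> 1}"

lemma sphere_area_eq: "sphere_area k = real (k + 1) * unit_ball_vol (real (k + 1))"
proof -
  have "{x \<in> space (\<Pi>\<^sub>M i\<in>{..k}. lborel :: real measure). (\<Sum>i\<le>k. (x i)\<^sup>2) \<le> (1::real)} =
      {x. sqrt (\<Sum>i\<in>{..k}. (x i)\<^sup>2) \<le> 1} \<inter> space (\<Pi>\<^sub>M i\<in>{..k}. lborel)"
    by auto
  then show ?thesis
    using emeasure_cball_aux[of "{..k}" 1] by (simp add: sphere_area_def measure_def)
qed

lemma sphere_area_0: "sphere_area 0 = 2"
  by (simp add: sphere_area_eq)

lemma measure_surface_measure_sphere: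
  fixes k :: nat
  assumes "DIM('a::euclidean_space) = k + 1"
  shows "measure surface_measure (sphere (0::'a) 1) = sphere_area k"
proof -
  have "{t *\<^sub>R u | t u. 0 < t \<and> t < 1 \<and> u \<in> sphere (0::'a) 1} = ball 0 1 - {0}" (is "?R = ?L")
  proof (intro subset_antisym subsetI)
    fix x assume "x \<in> ?L"
    then have "x = norm x *\<^sub>R sgn x" "0 < norm x" "norm x < 1" "sgn x \<in> sphere 0 1"
      by (auto simp: sgn_div_norm)
    then show "x \<in> ?R" by blast
  qed auto
  moreover have "emeasure lborel (ball (0::'a) 1 - {0}) = emeasure lborel (ball (0::'a) 1)"
    by (intro emeasure_Diff_null_set) auto
  ultimately have "emeasure surface_measure (sphere (0::'a) 1) =
      ennreal (real (k + 1) * unit_ball_vol (real (k + 1)))"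
    using assms
    by (simp add: emeasure_surface_measure emeasure_ball ennreal_mult ennreal_of_nat_eq_real_of_nat
        del: of_nat_Suc of_nat_add)
  then show ?thesis by (simp add: measure_def sphere_area_eq)
qed


section \<open>The distance and the constants\<close>

text \<open>
  The distance is an extended nonnegative real, so that no integrability has to be presupposed.
\<close>

definition L1_dist :: "(real \<Rightarrow> int) \<Rightarrow> (real \<Rightarrow> int) \<Rightarrow> ennreal" where
  "L1_dist p q = (\<integral>\<^sup>+a. ennreal (real_of_int \<bar>p a - q a\<bar>) \<partial>lborel)"

definition d_ECT :: "('a::euclidean_space \<Rightarrow> real \<Rightarrow> int) \<Rightarrow> ('a \<Rightarrow> real \<Rightarrow> int) \<Rightarrow> ennreal" where
  "d_ECT E F = (\<integral>\<^sup>+\<nu>. L1_dist (E \<nu>) (F \<nu>) \<partial>surface_measure)"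

definition C_dim :: "nat \<Rightarrow> real" where
  "C_dim d = 2 * sphere_area (d - 2) * integral {0..pi/2} (\<lambda>\<theta>. cos \<theta> * sin \<theta> ^ (d - 2))"

definition C_complex :: "'v set \<Rightarrow> 'v set set \<Rightarrow> nat" where
  "C_complex V K = Max ((\<lambda>v. card {\<sigma> \<in> K. v \<in> \<sigma>}) ` V)"

end

(* A simplex contributes at most the change of its height to the L1 distance of the Euler
   characteristic curves, and that change is at most the sum of |<f v - g v, nu>| over its vertices v.
   Regrouping by vertices, it remains to bound the integral of |<w, nu>| over the sphere by
   2 C_d |w|. Its exact value is C_d |w|, but by Cauchy-Schwarz it is enough to know the integral of
   <w, nu>^2, for which invariance under coordinate permutations and sign changes suffices; no
   integration in polar coordinates is needed. The volumes of consecutive unit balls are compared by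
   log-convexity of the Gamma function. *)

theory Submission
  imports Defs
begin

section \<open>Integration over the sphere\<close>

text \<open>A diagonal map with entries of absolute value 1 has Jacobian factor 1. Flipping a single
  sign will make the cross terms of a squared linear form cancel.\<close>

lemma
  fixes s :: "'a::euclidean_space \<Rightarrow> real"
  assumes s: "\<And>e. e \<in> Basis \<Longrightarrow> \<bar>s e\<bar> = 1"
  defines "T x \<equiv> \<Sum>e\<in>Basis. (s e * (x \<bullet> e)) *\<^sub>R e"
  shows lborel_distr_sign_change: "distr lborel borel T = lborel"
    and orthogonal_transformation_sign_change: "orthogonal_transformation T"
proof -
  have "s e \<noteq> 0" if "e \<in> Basis" for e using s[OF that] by auto
  then have "lborel = density (distr lborel borel (\<lambda>x. 0 + T x)) (\<lambda>_. ennreal (\<Prod>e\<in>Basis. \<bar>s e\<bar>))"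
    unfolding T_def by (rule lborel_affine_euclidean)
  then show "distr lborel borel T = lborel"
    by (simp add: s density_1)
  have T: "T x \<bullet> e = s e * (x \<bullet> e)" if "e \<in> Basis" for x e
    using that by (simp add: T_def)
  have "T x \<bullet> T y = x \<bullet> y" for x y
  proof -
    have "(T x \<bullet> e) * (T y \<bullet> e) = (x \<bullet> e) * (y \<bullet> e)" if "e \<in> Basis" for e
    proof -
      have "(T x \<bullet> e) * (T y \<bullet> e) = (s e * s e) * ((x \<bullet> e) * (y \<bullet> e))"
        using that by (simp add: T mult_ac)
      also have "s e * s e = 1"
        using s[OF that] abs_mult_self_eq[of "s e"] by simp
      finally show ?thesis by simp
    qed
    then show ?thesis
      unfolding euclidean_inner[of "T x" "T y"] euclidean_inner[of x y] by (intro sum.cong) auto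
  qed
  moreover have "linear T"
    by (rule linearI; rule euclidean_eqI) (simp_all add: T inner_add_left distrib_left)
  ultimately show "orthogonal_transformation T"
    by (simp add: orthogonal_transformation_def)
qed

text \<open>Such a map permutes the side lengths of a box and so keeps its volume, and
  \<open>lborel\<close> is determined by its values on boxes. Transpositions will make the
  coordinates on the sphere interchangeable.\<close>

lemma
  fixes p :: "'a::euclidean_space \<Rightarrow> 'a"
  assumes p: "p permutes Basis"
  defines "T x \<equiv> \<Sum>e\<in>Basis. (x \<bullet> p e) *\<^sub>R e"
  shows lborel_distr_permute_Basis: "distr lborel borel T = lborel"
    and orthogonal_transformation_permute_Basis: "orthogonal_transformation T"
proof -
  have T: "T x \<bullet> e = x \<bullet> p e" if "e \<in> Basis" for x e
    using that by (simp add: T_def)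
  have inv: "inv p e \<in> Basis" "p (inv p e) = e" if "e \<in> Basis" for e
    using p that permutes_in_image[OF permutes_inv[OF p]] by (auto simp: permutes_inverses)
  have pB: "p e \<in> Basis" if "e \<in> Basis" for e
    using p that by (simp add: permutes_in_image)
  have [measurable]: "T \<in> borel_measurable borel"
    unfolding T_def by measurable
  have "lborel = distr lborel borel T"
  proof (rule lborel_eqI)
    fix l u :: 'a
    assume le: "\<And>b. b \<in> Basis \<Longrightarrow> l \<bullet> b \<le> u \<bullet> b"
    \<comment> \<open>\<open>q\<close> is the inverse of \<open>T\<close>, so the preimage of a box
      is the box with corners \<open>q l\<close> and \<open>q u\<close>.\<close>
    define q where "q x = (\<Sum>e\<in>Basis. (x \<bullet> inv p e) *\<^sub>R e)" for x
    have q: "q x \<bullet> e = x \<bullet> inv p e" if "e \<in> Basis" for x e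
      using that by (simp add: q_def)
    have "T -` box l u = box (q l) (q u)"
    proof -
      have "(\<forall>e\<in>Basis. l \<bullet> e < x \<bullet> p e \<and> x \<bullet> p e < u \<bullet> e) \<longleftrightarrow>
          (\<forall>e\<in>Basis. l \<bullet> inv p e < x \<bullet> e \<and> x \<bullet> e < u \<bullet> inv p e)" for x
        using inv pB p by (metis permutes_inverses(2))
      then show ?thesis by (auto simp: mem_box T q)
    qed
    then have "emeasure (distr lborel borel T) (box l u) = emeasure lborel (box (q l) (q u))"
      by (subst emeasure_distr) auto
    also have "\<dots> = (\<Prod>b\<in>Basis. (u - l) \<bullet> inv p b)"
      using le inv by (subst emeasure_lborel_box) (auto simp: q inner_diff_left)
    also have "(\<Prod>b\<in>Basis. (u - l) \<bullet> inv p b) = (\<Prod>b\<in>Basis. (u - l) \<bullet> b)"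
      using prod.permute[OF permutes_inv[OF p], of "\<lambda>b. (u - l) \<bullet> b"] by (simp add: o_def)
    finally show "emeasure (distr lborel borel T) (box l u) = (\<Prod>b\<in>Basis. (u - l) \<bullet> b)" .
  qed simp
  then show "distr lborel borel T = lborel" by simp
  have "T x \<bullet> T y = x \<bullet> y" for x y
  proof -
    have "T x \<bullet> T y = (\<Sum>e\<in>Basis. (x \<bullet> p e) * (y \<bullet> p e))"
      unfolding euclidean_inner[of "T x" "T y"] by (intro sum.cong) (auto simp: T)
    also have "\<dots> = x \<bullet> y"
      unfolding euclidean_inner[of x y]
      using sum.permute[OF p, of "\<lambda>e. (x \<bullet> e) * (y \<bullet> e)"] by (simp add: o_def)
    finally show ?thesis .
  qed
  moreover have "linear T"
    by (rule linearI; rule euclidean_eqI) (simp_all add: T inner_add_left distrib_left)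
  ultimately show "orthogonal_transformation T"
    by (simp add: orthogonal_transformation_def)
qed

section \<open>Integrals against the surface measure\<close>

lemma borel_measurable_surface_measure:
  "F \<in> borel_measurable borel \<Longrightarrow> F \<in> borel_measurable surface_measure"
  by (simp add: measurable_cong_sets[OF sets_surface_measure] measurable_restrict_space1)

text \<open>The surface measure is a scaled image of volume under \<open>sgn\<close>, so a function
  on the sphere is integrated by extending it constantly along rays into the punctured ball.\<close>

lemma nn_integral_surface_measure:
  fixes F :: "'a::euclidean_space \<Rightarrow> ennreal"
  assumes F [measurable]: "F \<in> borel_measurable borel"
  shows "(\<integral>\<^sup>+\<nu>. F \<nu> \<partial>surface_measure) =
    of_nat DIM('a) * (\<integral>\<^sup>+x. F (sgn x) * indicator (ball 0 1 - {0}) x \<partial>lborel)"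
proof -
  let ?S = "restrict_space borel (sphere (0::'a) 1)"
  have m: "sgn \<in> measurable (restrict_space lborel (ball 0 1 - {0::'a})) ?S"
    by (intro measurable_restrict_space2 measurable_restrict_space1)
      (auto simp: space_restrict_space norm_sgn)
  have F': "F \<in> borel_measurable ?S"
    by (intro measurable_restrict_space1) simp
  show ?thesis
    unfolding surface_measure_def
    using F' by (simp add: nn_integral_scale_measure nn_integral_distr[OF m] nn_integral_restrict_space)
qed

text \<open>An orthogonal map commutes with \<open>sgn\<close> and preserves the punctured ball, so
  invariance of volume passes to the sphere. Invariance of \<open>lborel\<close> is a separate
  hypothesis, supplied above for sign changes and permutations.\<close>

lemma nn_integral_surface_measure_orthogonal:
  fixes F :: "'a::euclidean_space \<Rightarrow> ennreal" and T :: "'a \<Rightarrow> 'a"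
  assumes F [measurable]: "F \<in> borel_measurable borel"
    and T: "orthogonal_transformation T" and lborel: "distr lborel borel T = lborel"
  shows "(\<integral>\<^sup>+\<nu>. F (T \<nu>) \<partial>surface_measure) = (\<integral>\<^sup>+\<nu>. F \<nu> \<partial>surface_measure)"
proof -
  have meas [measurable]: "T \<in> borel_measurable borel"
    using T by (intro borel_measurable_continuous_onI linear_continuous_on
        linear_conv_bounded_linear[THEN iffD1] orthogonal_transformation_linear)
  let ?G = "\<lambda>x. F (sgn x) * indicator (ball 0 1 - {0}) x"
  have sgn: "sgn (T x) = T (sgn x)" for x
    using T by (simp add: sgn_div_norm orthogonal_transformation_norm orthogonal_transformation_scaleR)
  have norm: "norm (T x) = norm x" for x
    using T by (rule orthogonal_transformation_norm)
  then have zero: "T x = 0 \<longleftrightarrow> x = 0" for x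
    by (metis norm_eq_zero)
  have [measurable]: "(sgn :: 'a \<Rightarrow> 'a) \<in> borel_measurable borel"
    unfolding sgn_div_norm by measurable
  have [measurable]: "?G \<in> borel_measurable borel"
    by (intro borel_measurable_times_ennreal borel_measurable_indicator) auto
  have "(\<integral>\<^sup>+x. ?G x \<partial>lborel) = (\<integral>\<^sup>+x. ?G x \<partial>distr lborel borel T)"
    by (simp only: lborel)
  also have "\<dots> = (\<integral>\<^sup>+x. ?G (T x) \<partial>lborel)"
    by (subst nn_integral_distr) auto
  also have "\<dots> = (\<integral>\<^sup>+x. F (T (sgn x)) * indicator (ball 0 1 - {0}) x \<partial>lborel)"
    by (intro nn_integral_cong) (simp add: sgn norm zero indicator_def)
  finally show ?thesis
    by (simp add: nn_integral_surface_measure)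
qed

section \<open>Second moments of linear forms on the sphere\<close>

lemma nn_integral_surface_measure_1:
  "(\<integral>\<^sup>+\<nu>. 1 \<partial>(surface_measure :: 'a::euclidean_space measure)) =
    of_nat DIM('a) * ennreal (unit_ball_vol DIM('a))"
proof -
  have "emeasure lborel (ball (0::'a) 1 - {0}) = emeasure lborel (ball (0::'a) 1)"
    by (intro emeasure_Diff_null_set) auto
  then show ?thesis
    by (subst nn_integral_surface_measure) (simp_all add: emeasure_ball)
qed

text \<open>By symmetry all coordinates have the same second moment, and their squares sum to 1 on
  the sphere. Each moment is therefore the total area divided by the dimension.\<close>

lemma nn_integral_surface_measure_Basis_power2:
  fixes b :: "'a::euclidean_space"
  assumes b: "b \<in> Basis"
  shows "(\<integral>\<^sup>+\<nu>. ennreal ((\<nu> \<bullet> b)\<^sup>2) \<partial>surface_measure) = ennreal (unit_ball_vol DIM('a))"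
proof -
  define J where "J e = (\<integral>\<^sup>+\<nu>. ennreal ((\<nu> \<bullet> e)\<^sup>2) \<partial>surface_measure)" for e :: 'a
  have J: "J c = J b" if c: "c \<in> Basis" for c
  proof -
    let ?p = "Transposition.transpose b c"
    have p: "?p permutes Basis" using b c by (rule permutes_swap_id)
    have "J c = (\<integral>\<^sup>+\<nu>. ennreal (((\<Sum>e\<in>Basis. (\<nu> \<bullet> ?p e) *\<^sub>R e) \<bullet> c)\<^sup>2) \<partial>surface_measure)"
      unfolding J_def
      by (rule nn_integral_surface_measure_orthogonal[symmetric, OF _
            orthogonal_transformation_permute_Basis[OF p] lborel_distr_permute_Basis[OF p]]) simp
    also have "\<dots> = J b" using c by (simp add: J_def)
    finally show ?thesis .
  qed
  have "of_nat DIM('a) * J b = (\<Sum>e\<in>Basis. J e)"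
    by (simp add: J)
  also have "\<dots> = (\<integral>\<^sup>+\<nu>. (\<Sum>e\<in>Basis. ennreal ((\<nu> \<bullet> e)\<^sup>2)) \<partial>(surface_measure :: 'a measure))"
    unfolding J_def by (intro nn_integral_sum[symmetric] borel_measurable_surface_measure) simp
  also have "\<dots> = (\<integral>\<^sup>+\<nu>. 1 \<partial>(surface_measure :: 'a measure))"
  proof (intro nn_integral_cong)
    fix \<nu> :: 'a
    assume "\<nu> \<in> space surface_measure"
    then have "norm \<nu> = 1" by (simp add: space_surface_measure)
    then have "(\<Sum>e\<in>Basis. (\<nu> \<bullet> e)\<^sup>2) = 1"
      using euclidean_inner[of \<nu> \<nu>] by (simp add: power2_eq_square norm_eq_1)
    then show "(\<Sum>e\<in>Basis. ennreal ((\<nu> \<bullet> e)\<^sup>2)) = 1"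
      by (subst sum_ennreal) auto
  qed
  also have "\<dots> = of_nat DIM('a) * ennreal (unit_ball_vol DIM('a))"
    by (rule nn_integral_surface_measure_1)
  finally show ?thesis
    by (simp add: J_def ennreal_mult_cancel_left)
qed

text \<open>Induction on \<open>B\<close>: adding the integral to its copy reflected in the new
  coordinate cancels the cross terms. Only squares are ever integrated, so the argument stays within
  nonnegative integrals.\<close>

lemma nn_integral_surface_measure_sum_Basis_power2:
  fixes B :: "'a::euclidean_space set" and t :: "'a \<Rightarrow> real"
  assumes "B \<subseteq> Basis"
  shows "(\<integral>\<^sup>+\<nu>. ennreal ((\<Sum>e\<in>B. t e * (\<nu> \<bullet> e))\<^sup>2) \<partial>surface_measure) =
    ennreal ((\<Sum>e\<in>B. (t e)\<^sup>2) * unit_ball_vol DIM('a))"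
proof -
  have "finite B" using assms by (rule finite_subset) simp
  then show ?thesis using assms
  proof induction
    case (insert b B)
    let ?vol = "unit_ball_vol DIM('a)"
    let ?r = "\<lambda>\<nu>. \<Sum>e\<in>B. t e * (\<nu> \<bullet> e)"
    define I where "I = (\<integral>\<^sup>+\<nu>. ennreal ((t b * (\<nu> \<bullet> b) + ?r \<nu>)\<^sup>2) \<partial>surface_measure)"
    have b: "b \<in> Basis" and B: "\<And>e. e \<in> B \<Longrightarrow> e \<in> Basis" using insert.prems by auto
    \<comment> \<open>Reflection in the coordinate \<open>b\<close>. Since \<open>b\<close> is not
      in \<open>B\<close>, it leaves the remaining sum \<open>?r\<close> unchanged.\<close>
    define s where "s e = (if e = b then -1 else 1 :: real)" for e
    define T where "T x = (\<Sum>e\<in>Basis. (s e * (x \<bullet> e)) *\<^sub>R e)" for x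
    have s: "\<bar>s e\<bar> = 1" for e by (simp add: s_def)
    have T: "T \<nu> \<bullet> e = s e * (\<nu> \<bullet> e)" if "e \<in> Basis" for \<nu> e
      using that by (simp add: T_def)
    have rT: "?r (T \<nu>) = ?r \<nu>" for \<nu>
      using B insert.hyps(2) by (intro sum.cong) (auto simp: T s_def)
    have "I = (\<integral>\<^sup>+\<nu>. ennreal ((t b * (T \<nu> \<bullet> b) + ?r (T \<nu>))\<^sup>2) \<partial>surface_measure)"
      unfolding I_def T_def
      by (rule nn_integral_surface_measure_orthogonal[symmetric, OF _
            orthogonal_transformation_sign_change[OF s] lborel_distr_sign_change[OF s]]) measurable
    also have "\<dots> = (\<integral>\<^sup>+\<nu>. ennreal ((- (t b * (\<nu> \<bullet> b)) + ?r \<nu>)\<^sup>2) \<partial>surface_measure)"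
      unfolding rT using b by (simp add: T s_def)
    finally have reflected: "I = (\<integral>\<^sup>+\<nu>. ennreal ((- (t b * (\<nu> \<bullet> b)) + ?r \<nu>)\<^sup>2) \<partial>surface_measure)" .
    have "2 * I = (\<integral>\<^sup>+\<nu>. ennreal ((t b * (\<nu> \<bullet> b) + ?r \<nu>)\<^sup>2) \<partial>surface_measure) +
        (\<integral>\<^sup>+\<nu>. ennreal ((- (t b * (\<nu> \<bullet> b)) + ?r \<nu>)\<^sup>2) \<partial>surface_measure)"
      by (simp only: mult_2 flip: I_def reflected)
    also have "\<dots> = (\<integral>\<^sup>+\<nu>. ennreal ((t b * (\<nu> \<bullet> b) + ?r \<nu>)\<^sup>2) +
        ennreal ((- (t b * (\<nu> \<bullet> b)) + ?r \<nu>)\<^sup>2) \<partial>surface_measure)"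
      by (intro nn_integral_add[symmetric] borel_measurable_surface_measure) measurable
    \<comment> \<open>Pointwise, the mixed products of \<open>t b * (\<nu> \<bullet> b)\<close> and
      \<open>?r \<nu>\<close> in the two squares have opposite signs.\<close>
    also have "\<dots> = (\<integral>\<^sup>+\<nu>. ennreal (2 * (t b)\<^sup>2) * ennreal ((\<nu> \<bullet> b)\<^sup>2) + 2 * ennreal ((?r \<nu>)\<^sup>2)
        \<partial>surface_measure)"
    proof (intro nn_integral_cong)
      fix \<nu> :: 'a
      have "(t b * (\<nu> \<bullet> b) + ?r \<nu>)\<^sup>2 + (- (t b * (\<nu> \<bullet> b)) + ?r \<nu>)\<^sup>2 =
          2 * (t b)\<^sup>2 * (\<nu> \<bullet> b)\<^sup>2 + 2 * (?r \<nu>)\<^sup>2"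
        by (simp add: power2_eq_square algebra_simps)
      then show "ennreal ((t b * (\<nu> \<bullet> b) + ?r \<nu>)\<^sup>2) + ennreal ((- (t b * (\<nu> \<bullet> b)) + ?r \<nu>)\<^sup>2) =
          ennreal (2 * (t b)\<^sup>2) * ennreal ((\<nu> \<bullet> b)\<^sup>2) + 2 * ennreal ((?r \<nu>)\<^sup>2)"
        by (simp flip: ennreal_plus ennreal_mult ennreal_numeral)
    qed
    also have "\<dots> = ennreal (2 * (t b)\<^sup>2) * (\<integral>\<^sup>+\<nu>. ennreal ((\<nu> \<bullet> b)\<^sup>2) \<partial>surface_measure) +
        2 * (\<integral>\<^sup>+\<nu>. ennreal ((?r \<nu>)\<^sup>2) \<partial>surface_measure)"
    proof -
      have "(\<lambda>\<nu>. ennreal ((\<nu> \<bullet> b)\<^sup>2)) \<in> borel_measurable surface_measure"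
        "(\<lambda>\<nu>. ennreal ((?r \<nu>)\<^sup>2)) \<in> borel_measurable surface_measure"
        by (intro borel_measurable_surface_measure; measurable)+
      then show ?thesis by (simp add: nn_integral_add nn_integral_cmult)
    qed
    also have "\<dots> = ennreal (2 * (t b)\<^sup>2) * ennreal ?vol + 2 * ennreal ((\<Sum>e\<in>B. (t e)\<^sup>2) * ?vol)"
      using insert.IH insert.prems by (simp add: nn_integral_surface_measure_Basis_power2[OF b])
    also have "\<dots> = ennreal (2 * (t b)\<^sup>2 * ?vol + 2 * ((\<Sum>e\<in>B. (t e)\<^sup>2) * ?vol))"
      by (simp add: sum_nonneg flip: ennreal_plus ennreal_mult ennreal_numeral)
    also have "2 * (t b)\<^sup>2 * ?vol + 2 * ((\<Sum>e\<in>B. (t e)\<^sup>2) * ?vol) = 2 * ((\<Sum>e\<in>insert b B. (t e)\<^sup>2) * ?vol)"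
      using insert.hyps by (simp add: algebra_simps)
    also have "ennreal \<dots> = 2 * ennreal ((\<Sum>e\<in>insert b B. (t e)\<^sup>2) * ?vol)"
      by (simp add: ennreal_mult sum_nonneg)
    finally have "I = ennreal ((\<Sum>e\<in>insert b B. (t e)\<^sup>2) * ?vol)"
      by (simp add: ennreal_mult_cancel_left)
    then show ?case using insert.hyps by (simp add: I_def)
  qed simp
qed

text \<open>The coefficients are the coordinates of \<open>u\<close>, whose squares sum to
  1.\<close>

lemma nn_integral_surface_measure_inner_power2:
  fixes u :: "'a::euclidean_space"
  assumes u: "norm u = 1"
  shows "(\<integral>\<^sup>+\<nu>. ennreal ((u \<bullet> \<nu>)\<^sup>2) \<partial>surface_measure) = ennreal (unit_ball_vol DIM('a))"
proof -
  have "(\<Sum>e\<in>Basis. (u \<bullet> e)\<^sup>2) = 1"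
    using u euclidean_inner[of u u] by (simp add: power2_eq_square norm_eq_1)
  then show ?thesis
    using nn_integral_surface_measure_sum_Basis_power2[of Basis "\<lambda>e. u \<bullet> e"]
    by (simp flip: euclidean_inner)
qed

section \<open>Ball volumes, the constant \<open>C_dim\<close> and the first absolute moment\<close>

text \<open>With x = (n + 1)/2 the ratio of the two volumes is sqrt pi * Gamma (x + 1/2) / Gamma (x
  + 1), which log-convexity bounds by sqrt (pi / x). This would give the factor sqrt (2 * pi); the
  coarser 4 is chosen because 4 times the volume in dimension n equals
  \<open>2 * C_dim (n + 1)\<close> for n \<ge> 1.\<close>

lemma sqrt_mult_unit_ball_vol_Suc_le:
  "sqrt (real (Suc n)) * unit_ball_vol (real (Suc n)) \<le> 4 * unit_ball_vol (real n)"
proof -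
  define x where "x = real (Suc n) / 2"
  have x: "x > 0" by (simp add: x_def)
  have Gx: "Gamma x > 0" "Gamma (x + 1/2) > 0" "Gamma (x + 1) > 0"
    using x by (auto intro!: Gamma_real_pos)
  \<comment> \<open>The point x + 1/2 is the midpoint of x and x + 1.\<close>
  have "(ln \<circ> Gamma) ((1 - 1/2) *\<^sub>R x + (1/2) *\<^sub>R (x + 1))
      \<le> (1 - 1/2) * (ln \<circ> Gamma) x + (1/2) * (ln \<circ> Gamma) (x + 1)"
    using x by (intro convex_onD[OF log_convex_Gamma_real]) auto
  then have "2 * ln (Gamma (x + 1/2)) \<le> ln (Gamma x) + ln (Gamma (x + 1))"
    by (simp add: field_simps)
  also have "2 * ln (Gamma (x + 1/2)) = ln ((Gamma (x + 1/2))\<^sup>2)"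
    using Gx by (simp add: ln_realpow)
  also have "ln (Gamma x) + ln (Gamma (x + 1)) = ln (Gamma x * Gamma (x + 1))"
    using Gx by (simp add: ln_mult)
  finally have "(Gamma (x + 1/2))\<^sup>2 \<le> Gamma x * Gamma (x + 1)"
    using Gx by (subst (asm) ln_le_cancel_iff) auto
  \<comment> \<open>The functional equation Gamma (x + 1) = x * Gamma x eliminates Gamma x.\<close>
  also have "\<dots> = (Gamma (x + 1))\<^sup>2 / x"
    using x Gamma_plus1[of x] by (auto simp: power2_eq_square nonpos_Ints_def)
  finally have *: "x * (Gamma (x + 1/2))\<^sup>2 \<le> (Gamma (x + 1))\<^sup>2"
    using x by (simp add: field_simps)
  have "(sqrt (2 * x) * sqrt pi * Gamma (x + 1/2))\<^sup>2 = 2 * pi * (x * (Gamma (x + 1/2))\<^sup>2)"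
    using x by (simp add: power_mult_distrib)
  also have "\<dots> \<le> 16 * (Gamma (x + 1))\<^sup>2"
    using * pi_less_4 x by (intro mult_mono) auto
  also have "\<dots> = (4 * Gamma (x + 1))\<^sup>2"
    by (simp add: power_mult_distrib)
  finally have "sqrt (2 * x) * sqrt pi * Gamma (x + 1/2) \<le> 4 * Gamma (x + 1)"
    by (rule power2_le_imp_le) (use Gx in simp)
  then have "sqrt (2 * x) * (sqrt pi / Gamma (x + 1)) \<le> 4 * (1 / Gamma (x + 1/2))"
    using Gx by (simp add: divide_simps mult_ac)
  then have "pi powr (n / 2) * (sqrt (2 * x) * (sqrt pi / Gamma (x + 1)))
      \<le> pi powr (n / 2) * (4 * (1 / Gamma (x + 1/2)))"
    by (intro mult_left_mono) auto
  moreover have x_eq: "real (Suc n) / 2 + 1 = x + 1" "real n / 2 + 1 = x + 1/2" "2 * x = real (Suc n)"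
    by (auto simp: x_def field_simps)
  moreover have pi_eq: "pi powr (real (Suc n) / 2) = pi powr (n / 2) * sqrt pi"
    by (simp add: powr_half_sqrt[symmetric] powr_add[symmetric] field_simps)
  ultimately show ?thesis
    unfolding unit_ball_vol_def x_eq pi_eq by (simp add: mult_ac del: of_nat_Suc)
qed

text \<open>The integrand has antiderivative sin^(k+1) / (k+1), and the resulting 1/(k+1) cancels
  the factor k + 1 in \<open>sphere_area k\<close>. Geometrically, projecting the sphere onto a
  hyperplane through its centre covers the unit ball there twice.\<close>

lemma C_dim_eq: "C_dim (Suc (Suc k)) = 2 * unit_ball_vol (real (Suc k))"
proof -
  have "((\<lambda>\<theta>. cos \<theta> * sin \<theta> ^ k) has_integral
      sin (pi/2) ^ Suc k / real (Suc k) - sin 0 ^ Suc k / real (Suc k)) {0..pi/2}"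
    by (intro fundamental_theorem_of_calculus)
      (auto simp: has_real_derivative_iff_has_vector_derivative[symmetric]
        intro!: derivative_eq_intros simp del: of_nat_Suc power_Suc)
  then have "integral {0..pi/2} (\<lambda>\<theta>. cos \<theta> * sin \<theta> ^ k) = 1 / real (Suc k)"
    by (subst integral_unique) auto
  then show ?thesis
    by (simp add: C_dim_def sphere_area_eq del: of_nat_Suc)
qed

text \<open>
  The true value of the integral is half of this bound; the factor 2 leaves room for the
  Cauchy-Schwarz inequality, which loses a factor of at most \<open>sqrt (pi / 2)\<close>.
\<close>

lemma nn_integral_surface_measure_abs_inner_le:
  fixes w :: "'a::euclidean_space"
  assumes "DIM('a) \<ge> 2"
  shows "(\<integral>\<^sup>+\<nu>. ennreal \<bar>w \<bullet> \<nu>\<bar> \<partial>surface_measure) \<le> ennreal (2 * C_dim DIM('a) * norm w)"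
proof (cases "w = 0")
  case False
  define u where "u = sgn w"
  have u: "norm u = 1" using False by (simp add: u_def norm_sgn)
  have w: "w \<bullet> \<nu> = norm w * (u \<bullet> \<nu>)" for \<nu>
    using False by (simp add: u_def sgn_div_norm)
  define d where "d = DIM('a)"
  obtain k where k: "d = Suc (Suc k)"
    using assms by (metis d_def Suc_le_D numeral_2_eq_2 Suc_le_mono)
  \<comment> \<open>The mean of \<open>(u \<bullet> \<nu>)\<^sup>2\<close> over the sphere is 1/d.
    The weight sqrt d makes the two terms of the quadratic bound below contribute equally, which
    reproduces the Cauchy-Schwarz estimate.\<close>
  define s where "s = sqrt (real d)"
  have s: "s > 0" "s * s = real d" by (auto simp: s_def k)
  have meas: "(\<lambda>\<nu>. ennreal ((u \<bullet> \<nu>)\<^sup>2)) \<in> borel_measurable surface_measure"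
    by (intro borel_measurable_surface_measure) simp
  have "ennreal \<bar>w \<bullet> \<nu>\<bar> \<le> ennreal (norm w * s / 2) * ennreal ((u \<bullet> \<nu>)\<^sup>2) + ennreal (norm w / (2 * s)) * 1"
    for \<nu>
  proof -
    \<comment> \<open>Expanding the square bounds an absolute value pointwise by a square plus a
      constant, and both of these have known integrals.\<close>
    have "0 \<le> (s * \<bar>u \<bullet> \<nu>\<bar> - 1)\<^sup>2 / (2 * s)" using s by simp
    also have "\<dots> = s / 2 * (u \<bullet> \<nu>)\<^sup>2 + 1 / (2 * s) - \<bar>u \<bullet> \<nu>\<bar>"
      using s by (simp add: power2_eq_square field_simps)
    finally have "norm w * \<bar>u \<bullet> \<nu>\<bar> \<le> norm w * (s / 2 * (u \<bullet> \<nu>)\<^sup>2 + 1 / (2 * s))"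
      by (intro mult_left_mono) auto
    then have "\<bar>w \<bullet> \<nu>\<bar> \<le> norm w * s / 2 * (u \<bullet> \<nu>)\<^sup>2 + norm w / (2 * s)"
      by (simp add: w abs_mult algebra_simps)
    then show ?thesis
      using s by (simp flip: ennreal_mult ennreal_plus)
  qed
  then have "(\<integral>\<^sup>+\<nu>. ennreal \<bar>w \<bullet> \<nu>\<bar> \<partial>surface_measure) \<le>
      (\<integral>\<^sup>+\<nu>. ennreal (norm w * s / 2) * ennreal ((u \<bullet> \<nu>)\<^sup>2) + ennreal (norm w / (2 * s)) * 1 \<partial>surface_measure)"
    by (intro nn_integral_mono) auto
  also have "\<dots> = ennreal (norm w * s / 2) * (\<integral>\<^sup>+\<nu>. ennreal ((u \<bullet> \<nu>)\<^sup>2) \<partial>surface_measure) +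
      ennreal (norm w / (2 * s)) * (\<integral>\<^sup>+\<nu>. 1 \<partial>(surface_measure :: 'a measure))"
    using meas by (subst nn_integral_add) (simp_all add: nn_integral_cmult del: nn_integral_const mult_1_right)
  also have "\<dots> = ennreal (norm w * s / 2) * ennreal (unit_ball_vol d) +
      ennreal (norm w / (2 * s)) * (of_nat d * ennreal (unit_ball_vol d))"
    by (simp only: nn_integral_surface_measure_inner_power2[OF u] nn_integral_surface_measure_1 d_def)
  also have "\<dots> = ennreal (norm w * s / 2 * unit_ball_vol d + norm w / (2 * s) * (real d * unit_ball_vol d))"
    using s by (simp add: ennreal_of_nat_eq_real_of_nat flip: ennreal_mult ennreal_plus)
  also have "norm w * s / 2 * unit_ball_vol d + norm w / (2 * s) * (real d * unit_ball_vol d) =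
      norm w * (s * unit_ball_vol d)"
    using s by (simp add: s(2)[symmetric] field_simps)
  \<comment> \<open>The volume comparison is applied in dimension d - 1 = k + 1, where
    \<open>2 * C_dim d\<close> is 4 times the volume of the unit ball.\<close>
  also have "ennreal (norm w * (s * unit_ball_vol d)) \<le> ennreal (norm w * (2 * C_dim d))"
    using sqrt_mult_unit_ball_vol_Suc_le[of "Suc k"]
    by (intro ennreal_leI mult_left_mono) (auto simp: s_def k C_dim_eq)
  finally show ?thesis by (simp add: d_def mult_ac)
qed auto

section \<open>Euler characteristic curves\<close>

lemma simplex_vertices_embedding:
  assumes "embedding K f" "\<sigma> \<in> K"
  shows "simplex_vertices (geom_simplex f \<sigma>) = f ` \<sigma>"
  using assms by (intro simplex_vertices_geom_simplex) (auto simp: embedding_def)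

text \<open>A geometric simplex determines its extreme points, and injectivity on all vertices of
  \<open>K\<close> recovers the abstract simplex from them. Sums over geometric simplices can thus
  be indexed by \<open>K\<close>.\<close>

lemma inj_on_geom_simplex:
  assumes "embedding K f"
  shows "inj_on (geom_simplex f) K"
proof (rule inj_onI)
  fix \<sigma> \<tau> assume *: "\<sigma> \<in> K" "\<tau> \<in> K" "geom_simplex f \<sigma> = geom_simplex f \<tau>"
  then have "f ` \<sigma> = f ` \<tau>"
    using simplex_vertices_embedding[OF assms] by metis
  moreover have "inj_on f (\<Union>K)" using assms by (simp add: embedding_def)
  ultimately show "\<sigma> = \<tau>"
    using * inj_on_image_eq_iff[of f "\<Union>K" \<sigma> \<tau>] by blast
qed

text \<open>Here the signs and the index set depend on \<open>K\<close> alone, because an embedding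
  preserves the number of vertices. The curves of two embeddings therefore differ only in the
  thresholds of matching terms.\<close>

lemma ECC_geom_complex:
  assumes "embedding K f" "finite K"
  shows "ECC \<nu> (geom_complex f K) a =
    (\<Sum>\<sigma>\<in>K. (-1) ^ (card \<sigma> - 1) * (if Max ((\<lambda>v. f v \<bullet> \<nu>) ` \<sigma>) \<le> a then 1 else 0))"
proof -
  have h: "height \<nu> (geom_simplex f \<sigma>) = Max ((\<lambda>v. f v \<bullet> \<nu>) ` \<sigma>)" if "\<sigma> \<in> K" for \<sigma>
    using simplex_vertices_embedding[OF assms(1) that] by (simp add: height_def image_image)
  have c: "simplex_dim (geom_simplex f \<sigma>) = card \<sigma> - 1" if "\<sigma> \<in> K" for \<sigma>
  proof -
    have "inj_on f \<sigma>"
      using assms(1) that by (auto simp: embedding_def intro: inj_on_subset)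
    then show ?thesis
      using simplex_vertices_embedding[OF assms(1) that] by (simp add: simplex_dim_def card_image)
  qed
  have sub: "sublevel_complex (geom_complex f K) \<nu> a =
      geom_simplex f ` {\<sigma> \<in> K. Max ((\<lambda>v. f v \<bullet> \<nu>) ` \<sigma>) \<le> a}"
    using h by (auto simp: sublevel_complex_def geom_complex_def)
  have "ECC \<nu> (geom_complex f K) a =
      (\<Sum>\<sigma>\<in>{\<sigma> \<in> K. Max ((\<lambda>v. f v \<bullet> \<nu>) ` \<sigma>) \<le> a}. (-1) ^ simplex_dim (geom_simplex f \<sigma>))"
    unfolding ECC_def euler_char_def sub
    using inj_on_geom_simplex[OF assms(1)]
    by (subst sum.reindex) (auto intro: inj_on_subset)
  also have "\<dots> = (\<Sum>\<sigma>\<in>{\<sigma> \<in> K. Max ((\<lambda>v. f v \<bullet> \<nu>) ` \<sigma>) \<le> a}. (-1) ^ (card \<sigma> - 1))"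
    by (intro sum.cong) (auto simp: c)
  also have "\<dots> = (\<Sum>\<sigma>\<in>K. if Max ((\<lambda>v. f v \<bullet> \<nu>) ` \<sigma>) \<le> a then (-1) ^ (card \<sigma> - 1) else 0)"
    using assms(2) by (rule sum.inter_filter)
  also have "\<dots> = (\<Sum>\<sigma>\<in>K. (-1) ^ (card \<sigma> - 1) * (if Max ((\<lambda>v. f v \<bullet> \<nu>) ` \<sigma>) \<le> a then 1 else 0))"
    by (intro sum.cong) auto
  finally show ?thesis .
qed

text \<open>The maximum changes by at most the largest change of a value, which the sum dominates.
  The sum is kept because it can later be regrouped by vertices.\<close>

lemma abs_Max_image_diff_le:
  fixes p q :: "'v \<Rightarrow> real"
  assumes "finite \<sigma>" "\<sigma> \<noteq> {}"
  shows "\<bar>Max (p ` \<sigma>) - Max (q ` \<sigma>)\<bar> \<le> (\<Sum>v\<in>\<sigma>. \<bar>p v - q v\<bar>)"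
proof -
  have *: "Max (p ` \<sigma>) \<le> Max (q ` \<sigma>) + (\<Sum>v\<in>\<sigma>. \<bar>p v - q v\<bar>)" for p q :: "'v \<Rightarrow> real"
  proof (intro Max.boundedI)
    fix y assume "y \<in> p ` \<sigma>"
    then obtain v where v: "v \<in> \<sigma>" "y = p v" by auto
    have "q v \<le> Max (q ` \<sigma>)" using v assms by simp
    moreover have "\<bar>p v - q v\<bar> \<le> (\<Sum>v\<in>\<sigma>. \<bar>p v - q v\<bar>)"
      using v assms by (intro member_le_sum) auto
    ultimately show "y \<le> Max (q ` \<sigma>) + (\<Sum>v\<in>\<sigma>. \<bar>p v - q v\<bar>)" using v by linarith
  qed (use assms in auto)
  show ?thesis
    using *[of p q] *[of q p] by (simp add: abs_minus_commute abs_le_iff)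
qed

text \<open>The integrand is the indicator of the half-open interval between the two
  thresholds.\<close>

lemma nn_integral_abs_diff_threshold:
  fixes x y :: real
  shows "(\<integral>\<^sup>+a. ennreal \<bar>(if x \<le> a then 1 else 0) - (if y \<le> a then 1 else 0)\<bar> \<partial>lborel) = ennreal \<bar>x - y\<bar>"
proof -
  have "(\<integral>\<^sup>+a. ennreal \<bar>(if x \<le> a then 1 else 0) - (if y \<le> a then 1 else 0)\<bar> \<partial>lborel) =
      (\<integral>\<^sup>+a. indicator {min x y..<max x y} a \<partial>lborel)"
    by (intro nn_integral_cong) (auto simp: indicator_def)
  also have "\<dots> = ennreal \<bar>x - y\<bar>"
    by (auto simp: min_def max_def)
  finally show ?thesis .
qed

lemma L1_dist_ECC_le:
  assumes K: "finite K" "\<And>\<sigma>. \<sigma> \<in> K \<Longrightarrow> finite \<sigma> \<and> \<sigma> \<noteq> {}"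
    and f: "embedding K f" and g: "embedding K g"
  shows "L1_dist (ECC \<nu> (geom_complex f K)) (ECC \<nu> (geom_complex g K))
    \<le> ennreal (\<Sum>\<sigma>\<in>K. \<Sum>v\<in>\<sigma>. \<bar>(f v - g v) \<bullet> \<nu>\<bar>)"
proof -
  let ?F = "\<lambda>\<sigma>. Max ((\<lambda>v. f v \<bullet> \<nu>) ` \<sigma>)" and ?G = "\<lambda>\<sigma>. Max ((\<lambda>v. g v \<bullet> \<nu>) ` \<sigma>)"
  let ?D = "\<lambda>\<sigma> a. \<bar>(if ?F \<sigma> \<le> a then 1 else 0) - (if ?G \<sigma> \<le> a then 1 else 0) :: real\<bar>"
  have "real_of_int \<bar>ECC \<nu> (geom_complex f K) a - ECC \<nu> (geom_complex g K) a\<bar> \<le> (\<Sum>\<sigma>\<in>K. ?D \<sigma> a)" for a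
  proof -
    have "real_of_int \<bar>ECC \<nu> (geom_complex f K) a - ECC \<nu> (geom_complex g K) a\<bar> =
        \<bar>\<Sum>\<sigma>\<in>K. (-1) ^ (card \<sigma> - 1) * ((if ?F \<sigma> \<le> a then 1 else 0) - (if ?G \<sigma> \<le> a then 1 else 0) :: real)\<bar>"
      unfolding ECC_geom_complex[OF f K(1)] ECC_geom_complex[OF g K(1)] sum_subtractf[symmetric]
        right_diff_distrib[symmetric] of_int_abs of_int_sum
      by (intro arg_cong[where f = abs] sum.cong) auto
    \<comment> \<open>The triangle inequality removes the signs, which have absolute value
      1.\<close>
    also have "\<dots> \<le> (\<Sum>\<sigma>\<in>K. ?D \<sigma> a)"
      by (rule order_trans[OF sum_abs]) (simp add: abs_mult power_abs)
    finally show ?thesis .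
  qed
  then have "L1_dist (ECC \<nu> (geom_complex f K)) (ECC \<nu> (geom_complex g K))
      \<le> (\<integral>\<^sup>+a. (\<Sum>\<sigma>\<in>K. ennreal (?D \<sigma> a)) \<partial>lborel)"
    unfolding L1_dist_def by (intro nn_integral_mono) (simp add: sum_ennreal ennreal_leI)
  also have "\<dots> = (\<Sum>\<sigma>\<in>K. \<integral>\<^sup>+a. ennreal (?D \<sigma> a) \<partial>lborel)"
    by (intro nn_integral_sum) measurable
  also have "\<dots> = (\<Sum>\<sigma>\<in>K. ennreal \<bar>?F \<sigma> - ?G \<sigma>\<bar>)"
    by (simp only: nn_integral_abs_diff_threshold)
  also have "\<dots> \<le> (\<Sum>\<sigma>\<in>K. ennreal (\<Sum>v\<in>\<sigma>. \<bar>f v \<bullet> \<nu> - g v \<bullet> \<nu>\<bar>))"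
    using K by (intro sum_mono ennreal_leI abs_Max_image_diff_le) auto
  also have "\<dots> = ennreal (\<Sum>\<sigma>\<in>K. \<Sum>v\<in>\<sigma>. \<bar>(f v - g v) \<bullet> \<nu>\<bar>)"
    by (simp add: sum_ennreal sum_nonneg inner_diff_left)
  finally show ?thesis .
qed

section \<open>Counting incidences and the final estimate\<close>

text \<open>Double counting of pairs of a vertex and a simplex containing it: after the sums are
  exchanged, each \<open>x v\<close> occurs once per simplex through \<open>v\<close>.\<close>

lemma sum_simplices_le_C_complex:
  fixes x :: "'v \<Rightarrow> real"
  assumes K: "abstract_simplicial_complex V K" and x: "\<And>v. x v \<ge> 0"
  shows "(\<Sum>\<sigma>\<in>K. \<Sum>v\<in>\<sigma>. x v) \<le> real (C_complex V K) * (\<Sum>v\<in>V. x v)"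
proof -
  have V: "finite V" and sub: "\<And>\<sigma>. \<sigma> \<in> K \<Longrightarrow> \<sigma> \<subseteq> V"
    using K by (auto simp: abstract_simplicial_complex_def)
  then have fin: "finite K" by (meson PowI finite_Pow_iff finite_subset subsetI)
  have "(\<Sum>\<sigma>\<in>K. \<Sum>v\<in>\<sigma>. x v) = (\<Sum>\<sigma>\<in>K. \<Sum>v | v \<in> V \<and> v \<in> \<sigma>. x v)"
    using sub by (intro sum.cong) auto
  also have "\<dots> = (\<Sum>v\<in>V. \<Sum>\<sigma> | \<sigma> \<in> K \<and> v \<in> \<sigma>. x v)"
    using fin V by (rule sum.swap_restrict)
  also have "\<dots> = (\<Sum>v\<in>V. real (card {\<sigma> \<in> K. v \<in> \<sigma>}) * x v)"
    by simp
  \<comment> \<open>Every \<open>v\<close> in \<open>V\<close> has its count among those maximised.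
    For empty \<open>V\<close> the maximum is unspecified, but both sums are then empty.\<close>
  also have "\<dots> \<le> (\<Sum>v\<in>V. real (C_complex V K) * x v)"
    using V x by (intro sum_mono mult_right_mono) (auto simp: C_complex_def)
  finally show ?thesis by (simp add: sum_distrib_left)
qed

theorem theorem4p1:
  fixes V :: "'v set" and K :: "'v set set"
    and f g :: "'v \<Rightarrow> real ^ 'n"
  assumes "abstract_simplicial_complex V K"
    and "CARD('n) \<ge> 2"
    and "embedding K f" and "embedding K g"
  shows "d_ECT (ECT (geom_complex f K)) (ECT (geom_complex g K))
           \<le> ennreal (2 * real (C_complex V K) * C_dim CARD('n) * (\<Sum>v\<in>V. norm (f v - g v)))"
proof -
  let ?C = "real (C_complex V K)"
  have V: "finite V" and sub: "\<And>\<sigma>. \<sigma> \<in> K \<Longrightarrow> \<sigma> \<noteq> {} \<and> \<sigma> \<subseteq> V"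
    using assms(1) by (auto simp: abstract_simplicial_complex_def)
  have fin: "finite K" "\<And>\<sigma>. \<sigma> \<in> K \<Longrightarrow> finite \<sigma> \<and> \<sigma> \<noteq> {}"
    using V sub by (auto intro: finite_subset[of K "Pow V"] finite_subset[of _ V])
  have k: "CARD('n) = Suc (Suc (CARD('n) - 2))"
    using assms(2) by linarith
  have C: "C_dim CARD('n) \<ge> 0" by (subst k) (simp only: C_dim_eq, simp)
  have "L1_dist (ECT (geom_complex f K) \<nu>) (ECT (geom_complex g K) \<nu>)
      \<le> ennreal ?C * (\<Sum>v\<in>V. ennreal \<bar>(f v - g v) \<bullet> \<nu>\<bar>)"
    if "\<nu> \<in> space surface_measure" for \<nu>
  proof -
    have "L1_dist (ECT (geom_complex f K) \<nu>) (ECT (geom_complex g K) \<nu>)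
        \<le> ennreal (\<Sum>\<sigma>\<in>K. \<Sum>v\<in>\<sigma>. \<bar>(f v - g v) \<bullet> \<nu>\<bar>)"
      using that L1_dist_ECC_le[OF fin assms(3,4)] by (simp add: ECT_def space_surface_measure)
    also have "\<dots> \<le> ennreal (?C * (\<Sum>v\<in>V. \<bar>(f v - g v) \<bullet> \<nu>\<bar>))"
      using assms(1) by (intro ennreal_leI sum_simplices_le_C_complex) auto
    finally show ?thesis by (simp add: ennreal_mult sum_nonneg sum_ennreal)
  qed
  \<comment> \<open>Monotonicity of the nonnegative integral holds for arbitrary functions, so
    measurability of the curve distance in \<open>\<nu>\<close> is not at issue. The new integrand
    is continuous in \<open>\<nu>\<close>.\<close>
  then have "d_ECT (ECT (geom_complex f K)) (ECT (geom_complex g K))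
      \<le> (\<integral>\<^sup>+\<nu>. ennreal ?C * (\<Sum>v\<in>V. ennreal \<bar>(f v - g v) \<bullet> \<nu>\<bar>) \<partial>surface_measure)"
    unfolding d_ECT_def by (intro nn_integral_mono)
  also have "\<dots> = ennreal ?C * (\<Sum>v\<in>V. \<integral>\<^sup>+\<nu>. ennreal \<bar>(f v - g v) \<bullet> \<nu>\<bar> \<partial>surface_measure)"
  proof -
    have "(\<lambda>\<nu>. ennreal \<bar>w \<bullet> \<nu>\<bar>) \<in> borel_measurable surface_measure" for w :: "real ^ 'n"
      by (intro borel_measurable_surface_measure) simp
    then show ?thesis by (simp add: nn_integral_cmult nn_integral_sum del: sum_ennreal)
  qed
  also have "\<dots> \<le> ennreal ?C * (\<Sum>v\<in>V. ennreal (2 * C_dim CARD('n) * norm (f v - g v)))"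
    using assms(2) nn_integral_surface_measure_abs_inner_le[where 'a = "real ^ 'n"]
    by (intro mult_left_mono sum_mono) auto
  also have "\<dots> = ennreal (2 * ?C * C_dim CARD('n) * (\<Sum>v\<in>V. norm (f v - g v)))"
    using C by (simp add: sum_ennreal sum_nonneg sum_distrib_left mult_ac flip: ennreal_mult)
  finally show ?thesis .
qed

end
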